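(* Let $m\ge 2$ be an integer, let $H>0$, and let $Y$ be a random variable with $Y\ge 0$ and $\mathbb{E}[Y^{1/H}]<\infty$. Then, for $c=m^{-H}$, the recursive distributional equation $$X\overset{d}{=}Y+\max_{1\le i\le m}cX_i,$$ where $X_1,\dots,X_m$ are i.i.d. copies of $X$, independent of $Y$, admits a positive solution.
   Context: A solution of the equation is (the law of) a real-valued, almost surely finite random variable $X$ such that, if $X_1,\dots,X_m$ are i.i.d. with the law of $X$ and independent of $Y$, then $Y+\max_{1\le i\le m}cX_i$ has the same law as $X$. The solution is positive if $X>0$ almost surely. *)

theory Defs
  imports "HOL-Probability.Probability"
begin

definition rde_map :: "nat \<Rightarrow> real \<Rightarrow> real \<Rightarrow> (nat \<Rightarrow> real) \<Rightarrow> real" where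
  "rde_map m c y x = y + Max ((\<lambda>i. c * x i) ` {1..m})"

text \<open>\<open>\<nu>\<close> is the law of $Y$ and \<open>\<mu>\<close> the candidate law of $X$. The product measure
  is the joint law of $Y$ and of $X_1, \dots, X_m$, which are i.i.d. with law \<open>\<mu>\<close> and
  independent of $Y$; lemma \<open>rde_solution_iff_distr\<close> restates the definition in terms of such
  random variables on any probability space.\<close>

definition rde_solution :: "nat \<Rightarrow> real \<Rightarrow> real measure \<Rightarrow> real measure \<Rightarrow> bool" where
  "rde_solution m c \<nu> \<mu> \<longleftrightarrow>
     prob_space \<mu> \<and> sets \<mu> = sets borel \<and>
     distr (\<nu> \<Otimes>\<^sub>M (\<Pi>\<^sub>M i\<in>{1..m}. \<mu>)) borel (\<lambda>(y, x). rde_map m c y x) = \<mu>"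

lemma rde_map_measurable:
  assumes "sets \<nu> = sets borel" "sets \<mu> = sets borel"
  shows "(\<lambda>(y, x). rde_map m c y x) \<in> borel_measurable (\<nu> \<Otimes>\<^sub>M (\<Pi>\<^sub>M i\<in>{1..m}. \<mu>))"
proof -
  have [measurable]: "(\<lambda>p. snd p i) \<in> borel_measurable (borel \<Otimes>\<^sub>M (\<Pi>\<^sub>M i\<in>{1..m}. borel))"
    if "i \<in> {1..m}" for i
    using that by measurable
  have "(\<lambda>(y, x). rde_map m c y x) \<in> borel_measurable (borel \<Otimes>\<^sub>M (\<Pi>\<^sub>M i\<in>{1..m}. borel))"
    unfolding rde_map_def split_def
    by (intro borel_measurable_add borel_measurable_Max borel_measurable_times) auto
  moreover have "sets (\<nu> \<Otimes>\<^sub>M (\<Pi>\<^sub>M i\<in>{1..m}. \<mu>)) = sets (borel \<Otimes>\<^sub>M (\<Pi>\<^sub>M i\<in>{1..m}. borel))"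
    using assms by (intro sets_pair_measure_cong sets_PiM_cong) auto
  ultimately show ?thesis
    by (simp cong: measurable_cong_sets)
qed

lemma (in prob_space) rde_solution_iff_distr:
  fixes Y :: "'a \<Rightarrow> real" and X :: "nat \<Rightarrow> 'a \<Rightarrow> real"
  assumes indep: "indep_vars (\<lambda>_. borel) (\<lambda>i. if i = 0 then Y else X i) {0..m}"
    and law: "\<And>i. i \<in> {1..m} \<Longrightarrow> distr M borel (X i) = \<mu>"
    and m: "m \<ge> 1"
  shows "rde_solution m c (distr M borel Y) \<mu> \<longleftrightarrow>
    distr M borel (\<lambda>\<omega>. Y \<omega> + Max ((\<lambda>i. c * X i \<omega>) ` {1..m})) = \<mu>"
proof -
  define Z where "Z = (\<lambda>i. if i = 0 then Y else X i)"
  define L where "L = (\<lambda>i::nat. if i = 0 then distr M borel Y else \<mu>)"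
  define J where "J = {1..m}"
  have J: "finite J" "0 \<notin> J" "{0..m} = insert 0 J" by (auto simp: J_def)
  have rZ: "Z i \<in> borel_measurable M" if "i \<in> insert 0 J" for i
    using indep that unfolding indep_vars_def Z_def J(3) by auto
  have rY: "Y \<in> borel_measurable M" using rZ[of 0] by (simp add: Z_def)
  have rX: "X 1 \<in> borel_measurable M" using rZ[of 1] m by (simp add: Z_def J_def)
  have muX: "\<mu> = distr M borel (X 1)" using law[of 1] m by simp
  have mu: "prob_space \<mu>" "sets \<mu> = sets borel"
    unfolding muX using rX by (auto intro: prob_space_distr)
  have L: "prob_space (L i)" "sets (L i) = sets borel" for i
    using mu rY by (auto simp: L_def intro: prob_space_distr)
  have ZL: "distr M borel (Z i) = L i" if "i \<in> insert 0 J" for i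
    using that law by (auto simp: Z_def L_def J_def)
  let ?B = "\<Pi>\<^sub>M i\<in>insert 0 J. (borel :: real measure)"
  let ?g = "\<lambda>z. rde_map m c (z 0) z"
  have [measurable]: "(\<lambda>z. z i) \<in> borel_measurable ?B" if "i \<in> insert 0 J" for i
    using that by measurable
  have g: "?g \<in> borel_measurable ?B"
    unfolding rde_map_def
    by (intro borel_measurable_add borel_measurable_Max borel_measurable_times) (auto simp: J_def)
  have BL: "sets (\<Pi>\<^sub>M i\<in>insert 0 J. L i) = sets ?B"
    by (intro sets_PiM_cong) (auto simp: L)
  have Zm: "(\<lambda>\<omega>. \<lambda>i\<in>insert 0 J. Z i \<omega>) \<in> measurable M ?B"
    using rZ by (intro measurable_restrict) auto
  have rde_cong: "rde_map m c y x = rde_map m c y x'" if "\<And>i. i \<in> J \<Longrightarrow> x i = x' i" for y x x'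
    using that by (simp add: rde_map_def J_def cong: image_cong_simp)
  have "distr M ?B (\<lambda>\<omega>. \<lambda>i\<in>insert 0 J. Z i \<omega>) = (\<Pi>\<^sub>M i\<in>insert 0 J. distr M borel (Z i))"
    using indep rZ unfolding J(3) Z_def[symmetric]
    by (subst indep_vars_iff_distr_eq_PiM'[symmetric]) auto
  also have "\<dots> = (\<Pi>\<^sub>M i\<in>insert 0 J. L i)"
    by (intro PiM_cong ZL) auto
  finally have "distr (\<Pi>\<^sub>M i\<in>insert 0 J. L i) borel ?g =
      distr (distr M ?B (\<lambda>\<omega>. \<lambda>i\<in>insert 0 J. Z i \<omega>)) borel ?g"
    by simp
  also have "\<dots> = distr M borel (\<lambda>\<omega>. ?g (\<lambda>i\<in>insert 0 J. Z i \<omega>))"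
    using g Zm by (simp add: distr_distr comp_def)
  also have "(\<lambda>\<omega>. ?g (\<lambda>i\<in>insert 0 J. Z i \<omega>)) =
      (\<lambda>\<omega>. Y \<omega> + Max ((\<lambda>i. c * X i \<omega>) ` {1..m}))"
    by (simp add: rde_map_def Z_def J_def cong: image_cong_simp)
  finally have 1: "distr (\<Pi>\<^sub>M i\<in>insert 0 J. L i) borel ?g =
      distr M borel (\<lambda>\<omega>. Y \<omega> + Max ((\<lambda>i. c * X i \<omega>) ` {1..m}))" .
  have 2: "(\<Pi>\<^sub>M i\<in>J. L i) = (\<Pi>\<^sub>M i\<in>J. \<mu>)" "L 0 = distr M borel Y"
    using J by (auto simp: L_def intro!: PiM_cong)
  have "distr (L 0 \<Otimes>\<^sub>M (\<Pi>\<^sub>M i\<in>J. L i)) (\<Pi>\<^sub>M i\<in>insert 0 J. L i) (\<lambda>(y, x). x(0 := y))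
      = (\<Pi>\<^sub>M i\<in>insert 0 J. L i)"
    using L by (intro distr_pair_PiM_eq_PiM) auto
  then have "distr (\<Pi>\<^sub>M i\<in>insert 0 J. L i) borel ?g =
      distr (distr (L 0 \<Otimes>\<^sub>M (\<Pi>\<^sub>M i\<in>J. L i)) (\<Pi>\<^sub>M i\<in>insert 0 J. L i) (\<lambda>(y, x). x(0 := y))) borel ?g"
    by simp
  also have "\<dots> = distr (L 0 \<Otimes>\<^sub>M (\<Pi>\<^sub>M i\<in>J. L i)) borel (?g \<circ> (\<lambda>(y, x). x(0 := y)))"
  proof (rule distr_distr)
    show "?g \<in> borel_measurable (\<Pi>\<^sub>M i\<in>insert 0 J. L i)"
      using g BL by (simp cong: measurable_cong_sets)
    show "(\<lambda>(y, x). x(0 := y)) \<in> measurable (L 0 \<Otimes>\<^sub>M (\<Pi>\<^sub>M i\<in>J. L i)) (\<Pi>\<^sub>M i\<in>insert 0 J. L i)"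
      unfolding split_def
      by (rule measurable_fun_upd[where J = J]) auto
  qed
  also have "?g \<circ> (\<lambda>(y, x). x(0 := y)) = (\<lambda>(y, x). rde_map m c y x)"
    using J(2) by (auto simp: fun_eq_iff intro!: rde_cong)
  finally have "distr (distr M borel Y \<Otimes>\<^sub>M (\<Pi>\<^sub>M i\<in>{1..m}. \<mu>)) borel (\<lambda>(y, x). rde_map m c y x)
      = distr M borel (\<lambda>\<omega>. Y \<omega> + Max ((\<lambda>i. c * X i \<omega>) ` {1..m}))"
    unfolding 1 2 by (simp add: J_def)
  then show ?thesis
    using mu by (simp add: rde_solution_def)
qed

end

theory Submission
  imports Defs "HOL-Real_Asymp.Real_Asymp"
begin

text \<open>Put \<open>a = 1 / H\<close>, so that \<open>m * c powr a = 1\<close>. For \<open>Y = 0\<close> the equation is solved by the Frechet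
  law with cdf \<open>exp (- (x powr - a))\<close>. Iterating the map \<open>F \<mapsto> E (F ((x - Y) / c) ^ m)\<close> from this
  cdf gives a pointwise decreasing sequence, whose limit is a fixed point vanishing on \<open>x \<le> 0\<close>. The
  only issue is that no mass escapes to infinity. For this one shows inductively that the tails of
  all iterates are bounded for large \<open>x\<close> by
  \<open>h x = (1 + B x powr - p) * x powr - a * (1 + C * E (W\<^sup>2 / (x powr a + W)))\<close> with
  \<open>W = Y powr a\<close> and \<open>p = min 1 a\<close>. The decrease in \<open>x\<close> of the last factor pays for the event that $Y$ exceeds a
  fixed fraction of \<open>x\<close>, and that of the first factor pays for replacing \<open>x - Y\<close> by \<open>x\<close>
  on the complement. Finiteness of \<open>E W\<close> makes \<open>h\<close> tend to 0.\<close>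

section \<open>The recursive equation in terms of distribution functions\<close>

text \<open>For fixed \<open>y\<close> the event \<open>rde_map m c y x \<le> t\<close> is the box
  of all \<open>x\<close> with every coordinate at most \<open>(t - y) / c\<close>, because
  \<open>c > 0\<close>. Its product measure is an \<open>m\<close>-th power, and Tonelli integrates
  these slices over \<open>y\<close>.\<close>

lemma cdf_distr_rde_map:
  assumes nu: "real_distribution \<nu>" and mu: "real_distribution \<mu>" and m: "m \<ge> 1" and c: "c > 0"
  shows "cdf (distr (\<nu> \<Otimes>\<^sub>M (\<Pi>\<^sub>M i\<in>{1..m}. \<mu>)) borel (\<lambda>(y, x). rde_map m c y x)) t =
    (\<integral>y. cdf \<mu> ((t - y) / c) ^ m \<partial>\<nu>)"
proof -
  interpret nu: real_distribution \<nu> by fact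
  interpret mu: real_distribution \<mu> by fact
  let ?P = "\<Pi>\<^sub>M i\<in>{1..m}. \<mu>"
  interpret P: prob_space ?P by (intro prob_space_PiM) unfold_locales
  interpret fp: product_sigma_finite "\<lambda>_. \<mu>" by standard
  let ?f = "\<lambda>(y, x). rde_map m c y x"
  have f [measurable]: "?f \<in> borel_measurable (\<nu> \<Otimes>\<^sub>M ?P)"
    by (intro rde_map_measurable) auto
  have [measurable]: "cdf \<mu> \<in> borel_measurable borel"
    by (intro borel_measurable_mono monoI mu.cdf_nondecreasing)
  define A where "A = ?f -` {..t} \<inter> space (\<nu> \<Otimes>\<^sub>M ?P)"
  have A: "A \<in> sets (\<nu> \<Otimes>\<^sub>M ?P)"
    unfolding A_def by measurable
  have le: "rde_map m c y x \<le> t \<longleftrightarrow> (\<forall>i\<in>{1..m}. x i \<le> (t - y) / c)" for y x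
  proof -
    have "rde_map m c y x \<le> t \<longleftrightarrow> Max ((\<lambda>i. c * x i) ` {1..m}) \<le> t - y"
      by (auto simp: rde_map_def)
    also have "\<dots> \<longleftrightarrow> (\<forall>i\<in>{1..m}. c * x i \<le> t - y)"
      using m by (subst Max_le_iff) auto
    finally show ?thesis using c by (simp add: field_simps)
  qed
  have slice: "emeasure ?P (Pair y -` A) = ennreal (cdf \<mu> ((t - y) / c) ^ m)" for y
  proof -
    have "Pair y -` A = (\<Pi>\<^sub>E i\<in>{1..m}. {..(t - y) / c})"
      unfolding A_def using le
      by (auto simp: space_pair_measure space_PiM PiE_iff)
    then have "emeasure ?P (Pair y -` A) = (\<Prod>i\<in>{1..m}. emeasure \<mu> {..(t - y) / c})"
      by (simp add: fp.emeasure_PiM)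
    then show ?thesis
      by (simp add: mu.emeasure_eq_measure cdf_def ennreal_power)
  qed
  have int: "integrable \<nu> (\<lambda>y. cdf \<mu> ((t - y) / c) ^ m)"
    by (intro nu.integrable_const_bound[where B = 1])
       (auto simp: power_le_one mu.cdf_bounded_prob mu.cdf_nonneg)
  have "emeasure (distr (\<nu> \<Otimes>\<^sub>M ?P) borel ?f) {..t} = emeasure (\<nu> \<Otimes>\<^sub>M ?P) A"
    unfolding A_def by (rule emeasure_distr[OF f]) simp
  also have "\<dots> = (\<integral>\<^sup>+y. ennreal (cdf \<mu> ((t - y) / c) ^ m) \<partial>\<nu>)"
    unfolding P.emeasure_pair_measure_alt[OF A] slice ..
  also have "\<dots> = ennreal (\<integral>y. cdf \<mu> ((t - y) / c) ^ m \<partial>\<nu>)"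
    by (intro nn_integral_eq_integral int) (auto simp: mu.cdf_nonneg)
  finally show ?thesis
    by (simp add: cdf_def measure_def integral_nonneg_AE mu.cdf_nonneg)
qed

lemma rde_solution_iff_cdf:
  assumes nu: "real_distribution \<nu>" and mu: "real_distribution \<mu>" and m: "m \<ge> 1" and c: "c > 0"
  shows "rde_solution m c \<nu> \<mu> \<longleftrightarrow> (\<forall>t. (\<integral>y. cdf \<mu> ((t - y) / c) ^ m \<partial>\<nu>) = cdf \<mu> t)"
proof -
  interpret nu: real_distribution \<nu> by fact
  interpret mu: real_distribution \<mu> by fact
  let ?P = "\<Pi>\<^sub>M i\<in>{1..m}. \<mu>"
  interpret P: prob_space ?P by (intro prob_space_PiM) unfold_locales
  interpret nP: pair_prob_space \<nu> ?P ..
  let ?f = "\<lambda>(y, x). rde_map m c y x"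
  let ?D = "distr (\<nu> \<Otimes>\<^sub>M ?P) borel ?f"
  have D: "real_distribution ?D"
    by (intro nP.real_distribution_distr rde_map_measurable) auto
  have "?D = \<mu> \<longleftrightarrow> (\<forall>t. cdf ?D t = cdf \<mu> t)"
    using cdf_unique[OF D mu] by auto
  then show ?thesis
    using mu.prob_space_axioms
    unfolding rde_solution_def cdf_distr_rde_map[OF assms] by simp
qed

section \<open>The Frechet distribution function\<close>

definition frechet_cdf :: "real \<Rightarrow> real \<Rightarrow> real" where
  "frechet_cdf a x = (if x \<le> 0 then 0 else exp (- (x powr (- a))))"

lemma frechet_cdf_nonneg: "0 \<le> frechet_cdf a x"
  and frechet_cdf_le_1: "frechet_cdf a x \<le> 1"
  by (auto simp: frechet_cdf_def)

lemma mono_frechet_cdf: "a > 0 \<Longrightarrow> mono (frechet_cdf a)"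
  by (auto simp: mono_def frechet_cdf_def intro!: powr_mono2')

text \<open>Continuity at every point, including 0, is inherited by all iterates, and through them
  yields right-continuity of the limit.\<close>

lemma isCont_frechet_cdf:
  assumes a: "a > 0"
  shows "isCont (frechet_cdf a) x"
proof -
  consider "x < 0" | "x > 0" | "x = 0" by linarith
  then show ?thesis
  proof cases
    case 1
    have "\<forall>\<^sub>F y in nhds x. frechet_cdf a y = 0"
      using 1 eventually_nhds_in_open[of "{..<0}" x]
      by (auto simp: frechet_cdf_def elim!: eventually_mono)
    then show ?thesis by (subst isCont_cong) auto
  next
    case 2
    have "\<forall>\<^sub>F y in nhds x. frechet_cdf a y = exp (- (y powr (- a)))"
      using 2 eventually_nhds_in_open[of "{0<..}" x]
      by (auto simp: frechet_cdf_def elim!: eventually_mono)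
    then show ?thesis using 2 by (subst isCont_cong) (auto intro!: continuous_intros)
  next
    case 3
    have "((\<lambda>y. exp (- (y powr (- a)))) \<longlongrightarrow> 0) (at_right 0)"
      using a by real_asymp
    then have "(frechet_cdf a \<longlongrightarrow> 0) (at_right 0)"
      by (rule Lim_transform_eventually)
         (auto simp: frechet_cdf_def eventually_at_filter)
    moreover have "(frechet_cdf a \<longlongrightarrow> 0) (at_left 0)"
      by (rule Lim_transform_eventually[OF tendsto_const])
         (auto simp: frechet_cdf_def eventually_at_filter)
    ultimately show ?thesis
      using 3 by (simp add: isCont_def filterlim_at_split frechet_cdf_def)
  qed
qed

text \<open>Max-stability: scaling by \<open>1 / c\<close> multiplies the exponent by
  \<open>c powr a\<close>, the \<open>m\<close>-th power multiplies it by \<open>m\<close>, and the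
  two factors cancel.\<close>

lemma frechet_cdf_scale:
  assumes "c > 0" "real m * c powr a = 1"
  shows "frechet_cdf a (x / c) ^ m = frechet_cdf a x"
proof (cases "x \<le> 0")
  case True
  have "m \<noteq> 0" using assms by (cases m) auto
  then show ?thesis using True assms by (simp add: frechet_cdf_def divide_le_0_iff)
next
  case False
  have "(x / c) powr (- a) = c powr a * x powr (- a)"
    using False assms(1) by (simp add: powr_divide powr_minus field_simps)
  then have "real m * (x / c) powr (- a) = x powr (- a)"
    using assms(2) by (metis mult.assoc mult_1)
  then show ?thesis
    using False assms by (simp add: frechet_cdf_def divide_le_0_iff exp_of_nat_mult[symmetric])
qed

text \<open>Write the power as \<open>exp v\<close> with \<open>v = - b * ln (1 - t)\<close>. Then
  \<open>v\<close> is at most linear in \<open>t\<close> by \<open>ln z \<le> z - 1\<close>, and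
  \<open>exp v \<le> 1 + v * exp v\<close>. With \<open>b = 2 * a\<close> this measures the cost of
  replacing \<open>x - y\<close> by \<open>x\<close>.\<close>

lemma powr_one_minus_le_affine:
  fixes b \<eta> :: real
  assumes "b \<ge> 0" "\<eta> < 1"
  shows "\<exists>K\<ge>0. \<forall>t. 0 \<le> t \<longrightarrow> t \<le> \<eta> \<longrightarrow> (1 - t) powr (- b) \<le> 1 + K * t"
proof (intro exI conjI allI impI)
  define L where "L = b / (1 - \<eta>)"
  have L: "L \<ge> 0" using assms by (simp add: L_def)
  then show "0 \<le> L * exp L" by simp
  fix t :: real assume t: "0 \<le> t" "t \<le> \<eta>"
  then have t1: "t < 1" using assms by simp
  define v where "v = b * ln (1 / (1 - t))"
  have "v \<le> b * (1 / (1 - t) - 1)"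
    unfolding v_def using t1 assms by (intro mult_left_mono ln_le_minus_one) auto
  also have "1 / (1 - t) - 1 = t / (1 - t)"
    using t1 by (simp add: field_simps)
  also have "b * (t / (1 - t)) \<le> b * (t / (1 - \<eta>))"
    using t t1 assms by (intro mult_left_mono divide_left_mono) auto
  finally have v: "v \<le> L * t" by (simp add: L_def)
  also have "\<dots> \<le> L" using t1 t L by (simp add: mult_left_le)
  finally have vL: "v \<le> L" .
  have v0: "0 \<le> v" unfolding v_def using t t1 assms by (intro mult_nonneg_nonneg ln_ge_zero) auto
  have "(1 - v) * exp v \<le> exp (- v) * exp v"
    using exp_ge_add_one_self[of "- v"] by (intro mult_right_mono) auto
  then have "exp v \<le> 1 + v * exp v"
    by (simp add: algebra_simps flip: exp_add)
  also have "v * exp v \<le> (L * t) * exp L"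
    using v vL v0 L t by (intro mult_mono) auto
  finally show "(1 - t) powr (- b) \<le> 1 + L * exp L * t"
    using t1 by (simp add: powr_def v_def ln_div mult_ac)
qed

section \<open>The decreasing iteration and its limit\<close>

locale critical_rde = real_distribution \<nu> for \<nu> :: "real measure" +
  fixes a c :: real and m :: nat
  assumes a_pos: "a > 0" and c_pos: "c > 0" and c_less_1: "c < 1"
    and critical: "real m * c powr a = 1"
    and nonneg: "AE y in \<nu>. 0 \<le> y"
    and moment: "integrable \<nu> (\<lambda>y. y powr a)"
begin

primrec iter :: "nat \<Rightarrow> real \<Rightarrow> real" where
  "iter 0 = frechet_cdf a"
| "iter (Suc n) = (\<lambda>x. \<integral>y. iter n ((x - y) / c) ^ m \<partial>\<nu>)"

text \<open>The properties go through one induction together: continuity passes to the next iterate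
  by dominated convergence, where measurability comes from monotonicity and the dominating constant
  1 from the bounds.\<close>

lemma iter_regular: "isCont (iter n) x \<and> mono (iter n) \<and> 0 \<le> iter n x \<and> iter n x \<le> 1"
proof (induction n arbitrary: x)
  case 0
  then show ?case
    using isCont_frechet_cdf mono_frechet_cdf a_pos
    by (auto simp: frechet_cdf_nonneg frechet_cdf_le_1)
next
  case (Suc n)
  then have cont: "isCont (iter n) x" and mono: "mono (iter n)"
    and nn: "0 \<le> iter n x" and le1: "iter n x \<le> 1" for x by auto
  have [measurable]: "iter n \<in> borel_measurable borel"
    by (intro borel_measurable_mono mono)
  have int: "integrable \<nu> (\<lambda>y. iter n ((x - y) / c) ^ m)" for x
    by (intro integrable_const_bound[where B = 1]) (auto simp: power_le_one nn le1)
  have "isCont (iter (Suc n)) x"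
    unfolding continuous_at_sequentially comp_def
  proof (intro allI impI)
    fix X assume X: "X \<longlonglongrightarrow> x"
    show "(\<lambda>k. iter (Suc n) (X k)) \<longlonglongrightarrow> iter (Suc n) x"
      unfolding iter.simps
    proof (rule integral_dominated_convergence[where w = "\<lambda>_. 1"])
      show "AE y in \<nu>. (\<lambda>k. iter n ((X k - y) / c) ^ m) \<longlonglongrightarrow> iter n ((x - y) / c) ^ m"
        using X c_pos
        by (intro AE_I2 tendsto_power isCont_tendsto_compose[OF cont] tendsto_intros) auto
    qed (auto simp: power_le_one nn le1)
  qed
  moreover have "mono (iter (Suc n))"
    unfolding iter.simps using c_pos
    by (intro monoI integral_mono int power_mono nn monoD[OF mono] divide_right_mono) auto
  moreover have "iter (Suc n) x \<le> (\<integral>y. 1 \<partial>\<nu>)"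
    unfolding iter.simps by (intro integral_mono int) (auto simp: power_le_one nn le1)
  ultimately show ?case
    using prob_space by (auto simp: nn intro!: integral_nonneg_AE)
qed

lemma isCont_iter: "isCont (iter n) x" and mono_iter: "mono (iter n)"
  and iter_nonneg: "0 \<le> iter n x" and iter_le_1: "iter n x \<le> 1"
  using iter_regular by auto

lemma iter_measurable [measurable]: "iter n \<in> borel_measurable borel"
  by (intro borel_measurable_mono mono_iter)

lemma integrable_iter: "integrable \<nu> (\<lambda>y. iter n ((x - y) / c) ^ m)"
  by (intro integrable_const_bound[where B = 1])
     (auto simp: power_le_one iter_nonneg iter_le_1)

text \<open>In the first step, dropping \<open>y \<ge> 0\<close> can only increase the integrand,
  and max-stability then returns the Frechet cdf. Later steps follow because the iterated map is
  monotone on nonnegative functions.\<close>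

lemma iter_Suc_le: "iter (Suc n) x \<le> iter n x"
proof (induction n arbitrary: x)
  case 0
  have "iter (Suc 0) x \<le> (\<integral>y. frechet_cdf a (x / c) ^ m \<partial>\<nu>)"
    unfolding iter.simps
  proof (rule integral_mono_AE)
    show "AE y in \<nu>. frechet_cdf a ((x - y) / c) ^ m \<le> frechet_cdf a (x / c) ^ m"
      using nonneg
    proof eventually_elim
      case (elim y)
      then have "(x - y) / c \<le> x / c"
        using c_pos by (simp add: divide_right_mono)
      then show ?case
        by (intro power_mono monoD[OF mono_frechet_cdf[OF a_pos]] frechet_cdf_nonneg)
    qed
  qed (use integrable_iter[of 0] in simp_all)
  then show ?case
    using prob_space frechet_cdf_scale[OF c_pos critical] by simp
next
  case (Suc n)
  then show ?case
    unfolding iter.simps(2)[of "Suc n"] iter.simps(2)[of n]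
    using integrable_iter[of "Suc n"] integrable_iter[of n]
    by (intro integral_mono power_mono) (auto simp: iter_nonneg integral_nonneg_AE)
qed

lemma decseq_iter: "decseq (\<lambda>n. iter n x)"
  by (intro decseq_SucI iter_Suc_le)

definition limit_cdf :: "real \<Rightarrow> real" where
  "limit_cdf x = lim (\<lambda>n. iter n x)"

lemma iter_tendsto: "(\<lambda>n. iter n x) \<longlonglongrightarrow> limit_cdf x"
proof -
  obtain L where "(\<lambda>n. iter n x) \<longlonglongrightarrow> L"
    by (rule decseq_convergent[OF decseq_iter[of x], of 0]) (simp_all add: iter_nonneg)
  then show ?thesis
    unfolding limit_cdf_def by (simp add: limI)
qed

lemma limit_cdf_le_iter: "limit_cdf x \<le> iter n x"
  using decseq_ge[OF decseq_iter iter_tendsto] .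

lemma limit_cdf_nonneg: "0 \<le> limit_cdf x"
  using iter_tendsto by (rule LIMSEQ_le_const) (auto simp: iter_nonneg)

lemma limit_cdf_le_1: "limit_cdf x \<le> 1"
  using limit_cdf_le_iter iter_le_1 order_trans by blast

lemma mono_limit_cdf: "mono limit_cdf"
proof (intro monoI)
  fix x y :: real assume "x \<le> y"
  then show "limit_cdf x \<le> limit_cdf y"
    using monoD[OF mono_iter] by (intro LIMSEQ_le[OF iter_tendsto iter_tendsto]) auto
qed

text \<open>Monotonicity gives the lower estimate to the right of \<open>x\<close>. The upper one is
  the upper semicontinuity of a decreasing limit of continuous functions: some \<open>iter n\<close>
  is already below \<open>u\<close> at \<open>x\<close>, hence near \<open>x\<close>, and it
  dominates the limit.\<close>

lemma continuous_limit_cdf: "continuous (at_right x) limit_cdf"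
  unfolding continuous_within
proof (rule order_tendstoI)
  fix l assume l: "l < limit_cdf x"
  show "\<forall>\<^sub>F y in at_right x. l < limit_cdf y"
    using eventually_at_right_less[of x]
    by eventually_elim (intro less_le_trans[OF l] monoD[OF mono_limit_cdf] less_imp_le)
next
  fix u assume "limit_cdf x < u"
  from order_tendstoD(2)[OF iter_tendsto this] obtain n where n: "iter n x < u"
    by (auto simp: eventually_sequentially)
  have "(iter n \<longlongrightarrow> iter n x) (at_right x)"
    using isCont_iter continuous_at_imp_continuous_at_within continuous_within by blast
  from order_tendstoD(2)[OF this n]
  show "\<forall>\<^sub>F y in at_right x. limit_cdf y < u"
    by eventually_elim (rule le_less_trans[OF limit_cdf_le_iter])
qed

lemma limit_cdf_fixpoint: "(\<integral>y. limit_cdf ((x - y) / c) ^ m \<partial>\<nu>) = limit_cdf x"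
proof -
  have [measurable]: "limit_cdf \<in> borel_measurable borel"
    by (intro borel_measurable_mono mono_limit_cdf)
  have "(\<lambda>n. \<integral>y. iter n ((x - y) / c) ^ m \<partial>\<nu>) \<longlonglongrightarrow> (\<integral>y. limit_cdf ((x - y) / c) ^ m \<partial>\<nu>)"
    by (rule integral_dominated_convergence[where w = "\<lambda>_. 1"])
       (auto simp: power_le_one iter_nonneg iter_le_1 intro!: tendsto_power iter_tendsto)
  moreover have "(\<lambda>n. iter (Suc n) x) \<longlonglongrightarrow> limit_cdf x"
    using iter_tendsto by (rule LIMSEQ_Suc)
  ultimately show ?thesis
    using LIMSEQ_unique by auto
qed

section \<open>Truncated moments and the tail kernel\<close>

lemma integrable_indicator_greaterThan: "integrable \<nu> (indicator {z<..} :: real \<Rightarrow> real)"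
  by (intro integrable_real_indicator) (auto simp: less_top[symmetric])

text \<open>With \<open>W = y powr a\<close> and \<open>s > 0\<close>, the integrand lies within a
  factor 2 of \<open>min W (W^2 / s)\<close>. So a first moment of \<open>W\<close> suffices for
  integrability, while the integrand still decreases in \<open>s\<close> at a rate that can be
  compared with the event that \<open>W\<close> exceeds a multiple of \<open>s\<close>.\<close>

definition tail_moment :: "real \<Rightarrow> real" where
  "tail_moment s = (\<integral>y. (y powr a)\<^sup>2 / (s + y powr a) \<partial>\<nu>)"

lemma integrable_tail_moment:
  assumes "s > 0"
  shows "integrable \<nu> (\<lambda>y. (y powr a)\<^sup>2 / (s + y powr a))"
proof (rule Bochner_Integration.integrable_bound[OF moment])
  have "(y powr a)\<^sup>2 / (s + y powr a) \<le> y powr a" for y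
    using assms by (simp add: divide_le_eq add_pos_nonneg power2_eq_square algebra_simps)
  then show "AE y in \<nu>. norm ((y powr a)\<^sup>2 / (s + y powr a)) \<le> norm (y powr a)"
    using assms by (auto simp: add_nonneg_nonneg)
qed measurable

lemma tail_moment_nonneg: "s > 0 \<Longrightarrow> 0 \<le> tail_moment s"
  unfolding tail_moment_def by (intro integral_nonneg_AE) (auto simp: add_nonneg_nonneg)

lemma tail_moment_le:
  assumes "s > 0"
  shows "tail_moment s \<le> (\<integral>y. y powr a \<partial>\<nu>)"
  unfolding tail_moment_def using assms
  by (intro integral_mono integrable_tail_moment moment)
     (auto simp: divide_le_eq add_pos_nonneg power2_eq_square algebra_simps)

text \<open>Pointwise, the left integrand is \<open>W^2 / (s + W / r)\<close> with
  \<open>W = y powr a\<close>, and \<open>W / r \<ge> W\<close>.\<close>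

lemma tail_moment_scale:
  assumes "s > 0" "0 < r" "r \<le> 1"
  shows "r * tail_moment (r * s) \<le> tail_moment s"
proof -
  have "r * ((y powr a)\<^sup>2 / (r * s + y powr a)) \<le> (y powr a)\<^sup>2 / (s + y powr a)" for y
  proof -
    have "(y powr a)\<^sup>2 * (r * y powr a) \<le> (y powr a)\<^sup>2 * y powr a"
      using assms by (intro mult_left_mono) (auto intro: mult_left_le_one_le)
    then show ?thesis
      using assms by (simp add: divide_simps add_pos_nonneg algebra_simps)
  qed
  then have "(\<integral>y. r * ((y powr a)\<^sup>2 / (r * s + y powr a)) \<partial>\<nu>) \<le> tail_moment s"
    unfolding tail_moment_def using assms
    by (intro integral_mono integrable_mult_right integrable_tail_moment) auto
  then show ?thesis
    by (simp only: tail_moment_def integral_mult_right_zero)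
qed

lemma m_ge_2: "m \<ge> 2"
proof -
  have "c powr a < 1"
    using powr_less_mono2[of a c 1] a_pos c_pos c_less_1 by simp
  then have "real m * c powr a < 1" if "m \<le> 1"
    using that by (cases m) auto
  with critical show ?thesis by force
qed

text \<open>At \<open>s = x powr a\<close> this is the supersolution \<open>h x\<close> without its
  correction factor \<open>1 + B * x powr (- p)\<close>.\<close>

definition tail_kernel :: "real \<Rightarrow> real \<Rightarrow> real" where
  "tail_kernel C s = (1 + C * tail_moment s) / s"

text \<open>One factor \<open>1 / r\<close> comes from the denominator \<open>r * s\<close>, the
  other from \<open>tail_moment_scale\<close>.\<close>

lemma tail_kernel_scale:
  assumes "C \<ge> 0" "s > 0" "0 < r" "r \<le> 1"
  shows "tail_kernel C (r * s) \<le> tail_kernel C s / r\<^sup>2"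
proof -
  have "r * (1 + C * tail_moment (r * s)) \<le> 1 + C * tail_moment s"
    using assms mult_left_mono[OF tail_moment_scale[of s r], of C] by (simp add: algebra_simps)
  then have "r * (1 + C * tail_moment (r * s)) / (s * r\<^sup>2) \<le> (1 + C * tail_moment s) / (s * r\<^sup>2)"
    using assms by (intro divide_right_mono) auto
  then show ?thesis
    using assms by (simp add: tail_kernel_def power2_eq_square mult_ac)
qed

text \<open>With \<open>m * c powr a = 1\<close>, the left-hand side is what one step of the recursion does to the tail
  if the shift by $Y$ is ignored as long as $Y \le \eta x$.\<close>

lemma tail_kernel_step:
  assumes eta: "\<eta> > 0" and x: "x > 0"
    and C: "C = (1 / \<eta> powr a + 1) * (real m / \<eta> powr a + 1)"
  shows "prob {\<eta> * x<..} + m * tail_kernel C (m * x powr a) \<le> tail_kernel C (x powr a)"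
proof -
  define s where "s = x powr a"
  define e where "e = \<eta> powr a"
  have s: "s > 0" and e: "e > 0" and m: "real m \<ge> 2"
    using x eta m_ge_2 by (auto simp: s_def e_def)
  have C0: "C \<ge> 0" using e m by (auto simp: C e_def[symmetric])
  \<comment> \<open>The terms \<open>1 / s\<close> in \<open>tail_kernel C s\<close> and in
    \<open>m * tail_kernel C (m * s)\<close> coincide, so the difference of the two is exactly the
    integral of \<open>?d\<close>. A pointwise bound of the indicator by \<open>?d\<close> is
    therefore enough.\<close>
  let ?d = "\<lambda>y. C / s * ((y powr a)\<^sup>2 / (s + y powr a) - (y powr a)\<^sup>2 / (m * s + y powr a))"
  have le: "indicator {\<eta> * x<..} y \<le> ?d y" for y :: real
  proof -
    define w where "w = y powr a"
    have w: "w \<ge> 0" by (simp add: w_def)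
    have "w\<^sup>2 / (s + w) - w\<^sup>2 / (m * s + w) = s * ((real m - 1) * w\<^sup>2 / ((s + w) * (m * s + w)))"
    proof -
      have "s + w > 0" "m * s + w > 0" using s m w by (auto intro!: add_pos_nonneg)
      then have "w\<^sup>2 / (s + w) - w\<^sup>2 / (m * s + w) =
          (w\<^sup>2 * (m * s + w) - w\<^sup>2 * (s + w)) / ((s + w) * (m * s + w))"
        by (subst diff_frac_eq) auto
      also have "w\<^sup>2 * (m * s + w) - w\<^sup>2 * (s + w) = s * ((real m - 1) * w\<^sup>2)"
        by (simp add: algebra_simps)
      finally show ?thesis by simp
    qed
    then have eq: "?d y = C * (real m - 1) * w\<^sup>2 / ((s + w) * (m * s + w))"
      using s by (simp add: w_def)
    show ?thesis
    proof (cases "y > \<eta> * x")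
      case True
      then have "e * s \<le> w"
        unfolding e_def s_def w_def powr_mult[symmetric]
        using a_pos eta x by (intro powr_mono2) auto
      then have sw: "s \<le> w / e" and w0: "w > 0"
        using e s less_le_trans[of 0 "e * s" w] by (simp_all add: pos_le_divide_eq mult.commute)
      \<comment> \<open>Substituting \<open>s \<le> w / e\<close> turns the denominator into a
        multiple of \<open>w^2\<close>, and \<open>C\<close> is exactly that multiple. The remaining
        factor \<open>m - 1\<close> is at least 1.\<close>
      have "(s + w) * (m * s + w) \<le> (w / e + w) * (m * (w / e) + w)"
        using sw s w e by (intro mult_mono add_mono mult_left_mono) auto
      also have "\<dots> = C * w\<^sup>2"
        unfolding C e_def[symmetric]
        by (simp add: algebra_simps add_divide_distrib power2_eq_square)
      also have "\<dots> \<le> C * (real m - 1) * w\<^sup>2"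
        using m C0 mult_left_mono[of 1 "real m - 1" C] by (intro mult_right_mono) auto
      finally have "1 \<le> ?d y"
        unfolding eq using s w0 m by (subst le_divide_eq_1_pos) (simp_all add: add_pos_pos)
      then show ?thesis using True by simp
    next
      case False
      then show ?thesis
        unfolding eq using s w m C0
        by (simp add: divide_nonneg_nonneg mult_nonneg_nonneg add_nonneg_nonneg)
    qed
  qed
  have ms: "m * s > 0" using m s by simp
  have "prob {\<eta> * x<..} = (\<integral>y. indicator {\<eta> * x<..} y \<partial>\<nu>)"
    by simp
  also have "\<dots> \<le> (\<integral>y. ?d y \<partial>\<nu>)"
    using s ms
    by (intro integral_mono le integrable_mult_right Bochner_Integration.integrable_diff
        integrable_tail_moment integrable_indicator_greaterThan) auto
  also have "\<dots> = C / s * (tail_moment s - tail_moment (m * s))"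
    using s ms by (simp add: tail_moment_def integrable_tail_moment)
  also have "\<dots> = tail_kernel C s - m * tail_kernel C (m * s)"
  proof -
    have "m * tail_kernel C (m * s) = (1 + C * tail_moment (m * s)) / s"
      using m by (simp add: tail_kernel_def)
    then show ?thesis
      by (simp add: tail_kernel_def algebra_simps diff_divide_distrib add_divide_distrib)
  qed
  finally show ?thesis by (simp add: s_def)
qed

section \<open>A supersolution for the tails\<close>

text \<open>\<open>q x y\<close> majorizes the tail after one step, conditionally on
  \<open>Y = y\<close>: by \<open>m * h\<close> at the new argument for small \<open>y\<close>,
  trivially by 1 for large \<open>y\<close>. The threshold makes
  \<open>(x - y) / c \<ge> x / sqrt c\<close> for small \<open>y\<close>, so the argument moves
  outwards by a fixed factor.\<close>

lemma exists_supersolution: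
  obtains h :: "real \<Rightarrow> real" and x0 :: real and q :: "real \<Rightarrow> real \<Rightarrow> real"
  where "x0 > 0" and "(h \<longlongrightarrow> 0) at_top"
    and "\<And>x. x \<ge> x0 \<Longrightarrow> x powr (- a) \<le> h x"
    and "\<And>x. x \<ge> x0 \<Longrightarrow> integrable \<nu> (q x)"
    and "\<And>x. x \<ge> x0 \<Longrightarrow> (\<integral>y. q x y \<partial>\<nu>) \<le> h x"
    and "\<And>x y. x \<ge> x0 \<Longrightarrow> 0 \<le> y \<Longrightarrow> y \<le> (1 - sqrt c) * x \<Longrightarrow> m * h ((x - y) / c) \<le> q x y"
    and "\<And>x y. x \<ge> x0 \<Longrightarrow> y > (1 - sqrt c) * x \<Longrightarrow> 1 \<le> q x y"
proof -
  define \<eta> where "\<eta> = 1 - sqrt c"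
  have eta: "0 < \<eta>" "\<eta> < 1" using c_pos c_less_1 by (auto simp: \<eta>_def)
  obtain K where K: "K \<ge> 0" "\<And>t. 0 \<le> t \<Longrightarrow> t \<le> \<eta> \<Longrightarrow> (1 - t) powr (- (2 * a)) \<le> 1 + K * t"
    using powr_one_minus_le_affine[of "2 * a" \<eta>] a_pos eta by auto
  \<comment> \<open>\<open>p \<le> a\<close> makes \<open>y powr p\<close> integrable;
    \<open>p \<le> 1\<close> gives \<open>t \<le> t powr p\<close> on the unit interval. For
    \<open>a < 1\<close> the mean of \<open>Y\<close> may be infinite, so \<open>p = 1\<close> is
    not always available.\<close>
  define p where "p = min 1 a"
  have p: "0 < p" "p \<le> 1" "p \<le> a" using a_pos by (auto simp: p_def)
  have int_p: "integrable \<nu> (\<lambda>y. y powr p)"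
  proof (rule Bochner_Integration.integrable_bound)
    show "integrable \<nu> (\<lambda>y. 1 + y powr a)"
      using moment by simp
    have "y powr p \<le> 1 + y powr a" if "y \<ge> 0" for y
    proof (cases "y \<le> 1")
      case True
      then have "y powr p \<le> 1" using that p by (intro powr_le1) auto
      then show ?thesis by (simp add: add_increasing2)
    next
      case False
      then have "y powr p \<le> y powr a" using p by (intro powr_mono) auto
      then show ?thesis by simp
    qed
    with nonneg show "AE y in \<nu>. norm (y powr p) \<le> norm (1 + y powr a)"
      by (auto simp: add_nonneg_nonneg)
  qed measurable
  define \<kappa> where "\<kappa> = K * (\<integral>y. y powr p \<partial>\<nu>)"
  define \<rho> where "\<rho> = sqrt c powr p"
  \<comment> \<open>With \<open>u = x powr (- p)\<close>, the outward move of the argument gains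
    \<open>B * (1 - \<rho>) * u = 2 * \<kappa> * u\<close>. One half pays for the expected shift
    cost \<open>\<kappa> * u\<close>, the other for the cross term
    \<open>B * \<rho> * \<kappa> * u^2\<close>, provided
    \<open>\<kappa> * u \<le> (1 - \<rho>) / 2\<close>; this is what \<open>N\<close>
    ensures.\<close>
  define B where "B = 2 * \<kappa> / (1 - \<rho>)"
  define C where "C = (1 / \<eta> powr a + 1) * (real m / \<eta> powr a + 1)"
  have kappa: "\<kappa> \<ge> 0" using K by (auto simp: \<kappa>_def intro!: mult_nonneg_nonneg integral_nonneg_AE)
  have rho: "0 < \<rho>" "\<rho> < 1"
    using c_pos c_less_1 p powr_less_mono2[of p "sqrt c" 1] by (auto simp: \<rho>_def)
  have B: "B \<ge> 0" "B * (1 - \<rho>) = 2 * \<kappa>" using kappa rho by (auto simp: B_def)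
  have C: "C \<ge> 0" by (auto simp: C_def)
  define h where "h x = (1 + B * x powr (- p)) * tail_kernel C (x powr a)" for x
  \<comment> \<open>The indicator covers large \<open>y\<close>. In the product, the first factor
    bounds the correction factor of \<open>h\<close> at \<open>(x - y) / c\<close>, the second is
    the price of ignoring the shift, and the third is the kernel after an unshifted step.\<close>
  define q where "q x y = indicator {\<eta> * x<..} y +
    (1 + B * \<rho> * x powr (- p)) * (1 + K * (x powr (- p) * y powr p)) *
      (m * tail_kernel C (m * x powr a))" for x y :: real
  have kernel_nonneg: "0 \<le> tail_kernel C s" if "s > 0" for s
    using that C by (auto simp: tail_kernel_def tail_moment_nonneg)
  have pu: "((\<lambda>x::real. x powr (- p)) \<longlongrightarrow> 0) at_top"
    using p by real_asymp
  then have "((\<lambda>x. \<kappa> * x powr (- p)) \<longlongrightarrow> \<kappa> * 0) at_top"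
    by (intro tendsto_intros)
  then have "\<forall>\<^sub>F x in at_top. \<kappa> * x powr (- p) < (1 - \<rho>) / 2"
    using rho by (intro order_tendstoD) auto
  then obtain N where N: "\<And>x. x \<ge> N \<Longrightarrow> \<kappa> * x powr (- p) < (1 - \<rho>) / 2"
    by (auto simp: eventually_at_top_linorder)
  show ?thesis
  proof
    show "max 1 N > 0" by simp
    show "(h \<longlongrightarrow> 0) at_top"
    proof -
      define D where "D = 1 + C * (\<integral>y. y powr a \<partial>\<nu>)"
      have "((\<lambda>x. (1 + B * x powr (- p)) * (D * x powr (- a))) \<longlongrightarrow> (1 + B * 0) * (D * 0)) at_top"
        using a_pos by (intro tendsto_intros pu) real_asymp
      then have lim: "((\<lambda>x. (1 + B * x powr (- p)) * (D * x powr (- a))) \<longlongrightarrow> 0) at_top"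
        by simp
      have "\<forall>\<^sub>F x in at_top. h x \<le> (1 + B * x powr (- p)) * (D * x powr (- a))"
        using eventually_gt_at_top[of 0]
      proof eventually_elim
        case (elim x)
        have "tail_kernel C (x powr a) \<le> D / x powr a"
          using elim C unfolding tail_kernel_def D_def
          by (intro divide_right_mono add_left_mono mult_left_mono tail_moment_le) auto
        then show ?case
          using elim B unfolding h_def
          by (intro mult_left_mono) (auto simp: powr_minus_divide)
      qed
      moreover have "\<forall>\<^sub>F x in at_top. 0 \<le> h x"
        using eventually_gt_at_top[of 0]
        by eventually_elim (use B in \<open>auto simp: h_def intro!: mult_nonneg_nonneg kernel_nonneg\<close>)
      ultimately show ?thesis
        using tendsto_sandwich[OF _ _ tendsto_const lim] by simp
    qed
  next
    fix x assume "x \<ge> max 1 N"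
    then have x: "x > 0" and xN: "x \<ge> N" by auto
    define u where "u = x powr (- p)"
    define s where "s = x powr a"
    have u: "u > 0" and s: "s > 0" using x by (auto simp: u_def s_def)
    have m: "real m \<ge> 2" using m_ge_2 by simp
    have ms: "m * s > 0" using m s by simp
    have "x powr (- a) = 1 / s" by (simp add: s_def powr_minus_divide)
    also have "\<dots> \<le> 1 * tail_kernel C s"
      using s C tail_moment_nonneg[OF s] by (simp add: tail_kernel_def divide_right_mono)
    also have "\<dots> \<le> h x"
      unfolding h_def using B(1) kernel_nonneg[OF s] unfolding s_def by (intro mult_right_mono) auto
    finally show "x powr (- a) \<le> h x" .
    show int_q: "integrable \<nu> (q x)"
      unfolding q_def
      by (intro Bochner_Integration.integrable_add integrable_mult_left integrable_mult_right int_p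
          integrable_indicator_greaterThan) auto
    show "(\<integral>y. q x y \<partial>\<nu>) \<le> h x"
    proof -
      have "(\<integral>y. q x y \<partial>\<nu>) = prob {\<eta> * x<..} +
          (1 + B * \<rho> * u) * (1 + \<kappa> * u) * (m * tail_kernel C (m * s))"
      proof -
        have "(\<integral>y. 1 + K * (u * y powr p) \<partial>\<nu>) = 1 + \<kappa> * u"
          using int_p prob_space by (simp add: \<kappa>_def)
        then show ?thesis
          unfolding q_def u_def[symmetric] s_def[symmetric] using int_p
          by (subst Bochner_Integration.integral_add)
             (auto intro!: integrable_mult_left integrable_mult_right integrable_indicator_greaterThan)
      qed
      also have "(1 + B * \<rho> * u) * (1 + \<kappa> * u) \<le> 1 + B * u"
      proof -
        have "B * \<rho> * u * (\<kappa> * u) \<le> B * 1 * u * ((1 - \<rho>) / 2)"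
          using N[OF xN] B rho u kappa unfolding u_def[symmetric]
          by (intro mult_mono mult_nonneg_nonneg) auto
        also have "\<dots> = \<kappa> * u"
        proof -
          have "B * 1 * u * ((1 - \<rho>) / 2) = B * (1 - \<rho>) * u / 2" by simp
          then show ?thesis unfolding B(2) by simp
        qed
        finally have le: "B * \<rho> * u * (\<kappa> * u) \<le> \<kappa> * u" .
        show ?thesis
        proof -
          have "\<kappa> * u + \<kappa> * u = B * u - B * \<rho> * u"
            using arg_cong[OF B(2), of "\<lambda>x. x * u"] by (simp add: algebra_simps)
          with le show ?thesis
            by (simp add: algebra_simps)
        qed
      qed
      then have "(1 + B * \<rho> * u) * (1 + \<kappa> * u) * (m * tail_kernel C (m * s))
          \<le> (1 + B * u) * (m * tail_kernel C (m * s))"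
        using kernel_nonneg[OF ms] by (intro mult_right_mono) auto
      \<comment> \<open>The probability is enlarged by the same factor as the kernel term, so that
        \<open>tail_kernel_step\<close> applies to the sum.\<close>
      also have "prob {\<eta> * x<..} \<le> (1 + B * u) * prob {\<eta> * x<..}"
        using B u by (simp add: mult_le_cancel_right1)
      finally have "(\<integral>y. q x y \<partial>\<nu>) \<le>
          (1 + B * u) * (prob {\<eta> * x<..} + m * tail_kernel C (m * s))"
        by (simp add: algebra_simps)
      also have "\<dots> \<le> (1 + B * u) * tail_kernel C s"
        using B u tail_kernel_step[OF eta(1) x C_def] by (intro mult_left_mono) (auto simp: s_def)
      finally show ?thesis by (simp add: h_def u_def s_def)
    qed
    fix y
    have rest_nonneg: "0 \<le> (1 + B * \<rho> * u) * (1 + K * (u * y powr p)) * (m * tail_kernel C (m * s))"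
      using B rho u K kernel_nonneg[OF ms] by (intro mult_nonneg_nonneg add_nonneg_nonneg) auto
    {
      assume "y > (1 - sqrt c) * x"
      then show "1 \<le> q x y"
        using rest_nonneg by (simp add: q_def \<eta>_def u_def s_def)
    next
      assume y0: "0 \<le> y" and y1: "y \<le> (1 - sqrt c) * x"
      define t where "t = y / x"
      have t: "0 \<le> t" "t \<le> \<eta>" using y0 y1 x by (auto simp: t_def \<eta>_def field_simps)
      define z where "z = (x - y) / c"
      have "sqrt c * x / c \<le> z"
        unfolding z_def using y1 c_pos by (intro divide_right_mono) (auto simp: algebra_simps)
      moreover have "sqrt c * x / c = x / sqrt c"
        using c_pos by (simp add: divide_simps flip: power2_eq_square)
      ultimately have z: "x / sqrt c \<le> z" by simp
      have "z powr (- p) \<le> (x / sqrt c) powr (- p)"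
        using z x c_pos p by (intro powr_mono2') auto
      also have "\<dots> = \<rho> * u"
        using x c_pos by (simp add: \<rho>_def u_def powr_divide powr_minus field_simps)
      finally have zp: "z powr (- p) \<le> \<rho> * u" .
      \<comment> \<open>Since \<open>1 / c powr a = m\<close>, the shift changes the kernel argument
        \<open>m * s\<close> only by the factor \<open>r\<close>. By
        \<open>tail_kernel_scale\<close> this costs \<open>1 / r^2\<close>, whence the exponent
        \<open>2 * a\<close> in the choice of \<open>K\<close>.\<close>
      define r where "r = (1 - t) powr a"
      have r: "0 < r" "r \<le> 1"
        using t eta a_pos by (auto simp: r_def intro!: powr_le1)
      have "z powr a = (x * (1 - t)) powr a / c powr a"
        using x by (simp add: z_def t_def powr_divide algebra_simps)
      also have "\<dots> = r * (m * s)"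
      proof -
        have "1 / c powr a = m" using critical c_pos by (simp add: field_simps)
        then have "w / c powr a = w * m" for w
          by (metis mult.right_neutral times_divide_eq_right)
        then show ?thesis by (simp only: r_def s_def powr_mult mult_ac)
      qed
      finally have za: "z powr a = r * (m * s)" .
      have "1 / r\<^sup>2 = (1 - t) powr (- (2 * a))"
        using t eta by (simp add: r_def powr_minus_divide powr_power mult.commute)
      also have "\<dots> \<le> 1 + K * t" using K(2) t by blast
      also have "\<dots> \<le> 1 + K * t powr p"
        using powr_mono'[of p 1 t] p t eta K(1) by (intro add_left_mono mult_left_mono) auto
      also have "t powr p = u * y powr p"
        by (simp add: t_def u_def powr_divide powr_minus_divide)
      finally have rK: "1 / r\<^sup>2 \<le> 1 + K * (u * y powr p)" .
      have "tail_kernel C (z powr a) \<le> 1 / r\<^sup>2 * tail_kernel C (m * s)"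
        using tail_kernel_scale[OF C ms r] by (simp add: za)
      also have "\<dots> \<le> (1 + K * (u * y powr p)) * tail_kernel C (m * s)"
        by (intro mult_right_mono rK kernel_nonneg ms)
      finally have "h z \<le> (1 + B * (\<rho> * u)) * ((1 + K * (u * y powr p)) * tail_kernel C (m * s))"
        unfolding h_def using zp B rho u r ms za
        by (intro mult_mono add_left_mono mult_left_mono add_nonneg_nonneg mult_nonneg_nonneg kernel_nonneg) auto
      then have "m * h z \<le> m * \<dots>"
        by (intro mult_left_mono) auto
      also have "\<dots> \<le> q x y"
        by (simp add: q_def u_def s_def algebra_simps)
      finally show "m * h ((x - y) / c) \<le> q x y" by (simp add: z_def)
    }
  qed
qed

section \<open>Tightness and the solution\<close>

text \<open>The supersolution dominates the tail of the Frechet law and is preserved by each step,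
  so the bound is uniform in \<open>n\<close> and survives in the limit.\<close>

lemma iter_lower_bound:
  obtains h :: "real \<Rightarrow> real" and x0 :: real
  where "(h \<longlongrightarrow> 0) at_top" "\<And>n x. x \<ge> x0 \<Longrightarrow> 1 - h x \<le> iter n x"
proof (rule exists_supersolution)
  fix h :: "real \<Rightarrow> real" and x0 :: real and q :: "real \<Rightarrow> real \<Rightarrow> real"
  assume h: "x0 > 0" "(h \<longlongrightarrow> 0) at_top" "\<And>x. x \<ge> x0 \<Longrightarrow> x powr (- a) \<le> h x"
    and q: "\<And>x. x \<ge> x0 \<Longrightarrow> integrable \<nu> (q x)"
      "\<And>x. x \<ge> x0 \<Longrightarrow> (\<integral>y. q x y \<partial>\<nu>) \<le> h x"
      "\<And>x y. x \<ge> x0 \<Longrightarrow> 0 \<le> y \<Longrightarrow> y \<le> (1 - sqrt c) * x \<Longrightarrow> m * h ((x - y) / c) \<le> q x y"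
      "\<And>x y. x \<ge> x0 \<Longrightarrow> y > (1 - sqrt c) * x \<Longrightarrow> 1 \<le> q x y"
  have "1 - h x \<le> iter n x" if "x \<ge> x0" for n x
    using that
  proof (induction n arbitrary: x)
    case 0
    have "1 - x powr (- a) \<le> exp (- (x powr (- a)))"
      using exp_ge_add_one_self[of "- (x powr (- a))"] by simp
    then show ?case
      using h(1) h(3)[OF 0] 0 by (simp add: frechet_cdf_def)
  next
    case (Suc n)
    have "AE y in \<nu>. 1 - q x y \<le> iter n ((x - y) / c) ^ m"
      using nonneg
    proof eventually_elim
      case (elim y)
      show ?case
      proof (cases "y \<le> (1 - sqrt c) * x")
        case True
        let ?z = "(x - y) / c"
        \<comment> \<open>This keeps the new argument \<open>?z\<close> at or above
          \<open>x\<close>, hence in the range of the induction hypothesis.\<close>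
        have "c \<le> sqrt c"
          using c_pos c_less_1 by (simp add: real_le_rsqrt power2_eq_square mult_le_cancel_left1)
        then have "c * x \<le> sqrt c * x"
          using h(1) Suc.prems by (intro mult_right_mono) auto
        also have "\<dots> \<le> x - y" using True by (simp add: algebra_simps)
        finally have "?z \<ge> x0"
          using order_trans[OF Suc.prems, of ?z] c_pos by (simp add: le_divide_eq mult.commute)
        note IH = Suc.IH[OF this]
        have "1 - q x y \<le> 1 - m * h ?z"
          using q(3)[OF Suc.prems elim True] by simp
        also have "\<dots> \<le> 1 + m * (iter n ?z - 1)"
          using mult_left_mono[OF IH, of "real m"] by (simp add: algebra_simps)
        \<comment> \<open>Bernoulli acts as the union bound: the maximum of \<open>m\<close> copies
          has tail at most \<open>m\<close> times the single tail.\<close>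
        also have "\<dots> \<le> (1 + (iter n ?z - 1)) ^ m"
          using iter_nonneg by (intro Bernoulli_inequality) simp
        finally show ?thesis by simp
      next
        case False
        then show ?thesis
          using q(4)[OF Suc.prems, of y] zero_le_power[OF iter_nonneg[of n "(x - y) / c"], of m]
          by simp
      qed
    qed
    then have "(\<integral>y. 1 - q x y \<partial>\<nu>) \<le> iter (Suc n) x"
      unfolding iter.simps using q(1)[OF Suc.prems]
      by (intro integral_mono_AE integrable_iter) auto
    then show ?case
      using q(1,2)[OF Suc.prems] prob_space by simp
  qed
  with h(2) that show ?thesis by blast
qed

lemma limit_cdf_at_top: "(limit_cdf \<longlongrightarrow> 1) at_top"
proof -
  obtain h x0 where h: "(h \<longlongrightarrow> 0) at_top" "\<And>n x. x \<ge> x0 \<Longrightarrow> 1 - h x \<le> iter n x"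
    using iter_lower_bound by blast
  have "1 - h x \<le> limit_cdf x" if "x \<ge> x0" for x
    using iter_tendsto by (rule LIMSEQ_le_const) (use h(2) that in auto)
  then have lower: "\<forall>\<^sub>F x in at_top. 1 - h x \<le> limit_cdf x"
    by (auto intro: eventually_at_top_linorderI)
  have "((\<lambda>x. 1 - h x) \<longlongrightarrow> 1) at_top"
    using tendsto_diff[OF tendsto_const h(1), of 1] by simp
  from tendsto_sandwich[OF lower _ this tendsto_const] show ?thesis
    by (simp add: limit_cdf_le_1)
qed

lemma limit_cdf_nonpos: "x \<le> 0 \<Longrightarrow> limit_cdf x = 0"
  using limit_cdf_le_iter[of x 0] limit_cdf_nonneg[of x] by (simp add: frechet_cdf_def)

lemma exists_positive_solution: "\<exists>\<mu>. rde_solution m c \<nu> \<mu> \<and> (AE x in \<mu>. 0 < x)"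
proof -
  have bot: "(limit_cdf \<longlongrightarrow> 0) at_bot"
    by (intro tendsto_eventually eventually_mono[OF eventually_le_at_bot[of 0]] limit_cdf_nonpos)
  note F = monoD[OF mono_limit_cdf] continuous_limit_cdf bot
  let ?\<mu> = "interval_measure limit_cdf"
  interpret mu: real_distribution ?\<mu>
    by (intro real_distribution_interval_measure F limit_cdf_at_top)
  have cdf: "cdf ?\<mu> = limit_cdf"
    by (intro cdf_interval_measure F)
  have "rde_solution m c \<nu> ?\<mu>"
    using rde_solution_iff_cdf[OF real_distribution_axioms mu.real_distribution_axioms _ c_pos] m_ge_2
    by (simp add: cdf limit_cdf_fixpoint)
  \<comment> \<open>Positivity is inherited from the initial Frechet cdf, which vanishes up to and
    including 0 and dominates the limit.\<close>
  moreover have "emeasure ?\<mu> {..0} = 0"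
    using fun_cong[OF cdf, of 0] by (simp add: mu.emeasure_eq_measure cdf_def limit_cdf_nonpos)
  then have "AE x in ?\<mu>. 0 < x"
    by (intro AE_I[where N = "{..0}"]) auto
  ultimately show ?thesis by blast
qed

end

theorem corollary3:
  fixes M :: "'a measure" and Y :: "'a \<Rightarrow> real" and m :: nat and H :: real
  assumes "prob_space M"
    and "Y \<in> borel_measurable M"
    and "AE \<omega> in M. 0 \<le> Y \<omega>"
    and "integrable M (\<lambda>\<omega>. Y \<omega> powr (1 / H))"
    and "m \<ge> 2"
    and "H > 0"
  shows "\<exists>\<mu>. rde_solution m (real m powr (- H)) (distr M borel Y) \<mu> \<and> (AE x in \<mu>. 0 < x)"
proof -
  interpret prob_space M by fact
  let ?\<nu> = "distr M borel Y"
  let ?c = "real m powr (- H)"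
  interpret nu: real_distribution ?\<nu>
    using assms(2) by (rule real_distribution_distr)
  \<comment> \<open>The instance is \<open>a = 1 / H\<close>, for which \<open>c powr a\<close> is
    \<open>1 / m\<close>; nonnegativity and the moment condition pass from \<open>Y\<close> to its
    law.\<close>
  have "critical_rde ?\<nu> (1 / H) ?c m"
  proof
    show "real m * ?c powr (1 / H) = 1"
      using assms(5,6) by (simp add: powr_powr powr_neg_one)
    show "?c < 1"
      using assms(5,6) by (simp add: powr_minus_divide gr_one_powr)
  qed (use assms in \<open>auto simp: AE_distr_iff integrable_distr_eq\<close>)
  then show ?thesis
    by (rule critical_rde.exists_positive_solution)
qed

end
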